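(* Let $G$ be a graph with minimum degree at least $2$ whose NB-matrix $B$ is diagonalizable, with Perron eigenvalue $\lambda$. Let $G^c$ be the graph obtained from $G$ by adding a new node $c$ of degree $d$ (adjacent to $d$ nodes of $G$), and let $B^c$ be the NB-matrix of $G^c$. Then there exists a real number $\lambda_c$ with $\lambda_c>\lambda$ such that $-\lambda_c^2$ is an eigenvalue of $Y(\lambda_c)X$ and $\lambda_c$ is an eigenvalue of $B^c$.
   Context: Graphs are finite, simple, undirected, unweighted, connected (both $G$ and $G^c$). For a graph with set of oriented edges $\bar E$ (two for each undirected edge), the NB-matrix is indexed by $\bar E$ with entries $B_{k\to l,\,i\to j}=\delta_{jk}(1-\delta_{il})$. The Perron eigenvalue of $B$ is its positive real eigenvalue equal to its spectral radius. The resolvent of $B$ is $Y(t):=(B-tI)^{-1}$, for $t$ not an eigenvalue of $B$. $X$ is the matrix indexed by the oriented edges of $G$ with entries $X_{k\to l,\,i\to j}=a_{ck}a_{cj}(1-\delta_{jk})$, where $a_{ck}=1$ if $c$ is adjacent to $k$ in $G^c$ and $a_{ck}=0$ otherwise.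
   Formalization: The degree d of the new node c is assumed to be at least 2; for d = 1 the matrix X is zero, so −λ_c² with λ_c > λ > 0 cannot be an eigenvalue of Y(λ_c)X and the claim fails (e.g. a triangle with a pendant node). *)

theory Defs
  imports "Graph_Theory.Graph_Theory" "Jordan_Normal_Form.Spectral_Radius"
begin

text \<open>
  A finite simple undirected graph is a \<open>pair_graph\<close>: a finite, loop-free, symmetric digraph
  without parallel arcs. Its arc set \<open>parcs G\<close> is exactly the set of oriented edges, the pair
  \<open>(k, l)\<close> being the oriented edge from \<open>k\<close> to \<open>l\<close>.
\<close>

definition add_node :: "'a pair_pre_digraph \<Rightarrow> 'a \<Rightarrow> 'a set \<Rightarrow> 'a pair_pre_digraph" where
  "add_node G c N =
     \<lparr> pverts = insert c (pverts G), parcs = parcs G \<union> {c} \<times> N \<union> N \<times> {c} \<rparr>"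

lemma pair_graph_add_node:
  assumes "pair_graph G" "c \<notin> pverts G" "N \<subseteq> pverts G"
  shows "pair_graph (add_node G c N)"
proof -
  interpret G: pair_graph G by fact
  have fin: "finite N" using finite_subset[OF assms(3)] G.finite_verts by simp
  have sym: "\<And>u v. (u, v) \<in> parcs G \<Longrightarrow> (v, u) \<in> parcs G"
    using G.arcs_symmetric by auto
  have loop: "\<And>u. (u, u) \<notin> parcs G" using G.no_loops by force
  show ?thesis
    using fin assms(2,3) loop G.finite_verts G.finite_arcs
    by unfold_locales
      (auto simp: add_node_def symmetric_def intro!: symI dest: sym G.in_arcsD1 G.in_arcsD2)
qed

text \<open>
  Matrices in the library are indexed by initial segments of the naturals, so a matrix indexed by
  a finite set is transported along an enumeration \<open>es\<close> of that set. Two enumerations give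
  matrices that differ by a simultaneous permutation of rows and columns.
\<close>

definition enumerates :: "'b list \<Rightarrow> 'b set \<Rightarrow> bool" where
  "enumerates es A \<longleftrightarrow> distinct es \<and> set es = A"

definition indexed_mat :: "'b list \<Rightarrow> ('b \<Rightarrow> 'b \<Rightarrow> complex) \<Rightarrow> complex mat" where
  "indexed_mat es f = mat (length es) (length es) (\<lambda>(r, s). f (es ! r) (es ! s))"

definition kdelta :: "'a \<Rightarrow> 'a \<Rightarrow> complex" where
  "kdelta i j = (if i = j then 1 else 0)"

definition nb_entry :: "'a \<times> 'a \<Rightarrow> 'a \<times> 'a \<Rightarrow> complex" where
  "nb_entry = (\<lambda>(k, l) (i, j). kdelta j k * (1 - kdelta i l))"

definition nb_matrix :: "('a \<times> 'a) list \<Rightarrow> complex mat" where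
  "nb_matrix es = indexed_mat es nb_entry"

definition adj :: "'a pair_pre_digraph \<Rightarrow> 'a \<Rightarrow> 'a \<Rightarrow> complex" where
  "adj H u v = (if (u, v) \<in> parcs H then 1 else 0)"

text \<open>
  In \<open>X_matrix\<close>, \<open>H\<close> is the extended graph, which supplies the adjacencies of \<open>c\<close>, whereas
  \<open>es\<close> enumerates the oriented edges of the original graph.
\<close>

definition X_entry :: "'a pair_pre_digraph \<Rightarrow> 'a \<Rightarrow> 'a \<times> 'a \<Rightarrow> 'a \<times> 'a \<Rightarrow> complex" where
  "X_entry H c = (\<lambda>(k, l) (i, j). adj H c k * adj H c j * (1 - kdelta j k))"

definition X_matrix :: "'a pair_pre_digraph \<Rightarrow> 'a \<Rightarrow> ('a \<times> 'a) list \<Rightarrow> complex mat" where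
  "X_matrix H c es = indexed_mat es (X_entry H c)"

definition diagonalizable_mat :: "complex mat \<Rightarrow> bool" where
  "diagonalizable_mat A \<longleftrightarrow> (\<exists>D. diagonal_mat D \<and> similar_mat A D)"

definition perron_eigenvalue :: "complex mat \<Rightarrow> real \<Rightarrow> bool" where
  "perron_eigenvalue A \<mu> \<longleftrightarrow>
     0 < \<mu> \<and> eigenvalue A (complex_of_real \<mu>) \<and> \<mu> = spectral_radius A"

text \<open>The value is meaningful only when \<open>t\<close> is not an eigenvalue of \<open>A\<close>, see below.\<close>

definition resolvent :: "complex mat \<Rightarrow> complex \<Rightarrow> complex mat" where
  "resolvent A t = the (mat_inverse (A - t \<cdot>\<^sub>m 1\<^sub>m (dim_row A)))"

lemma resolvent_inverse:
  assumes A: "A \<in> carrier_mat n n" and t: "\<not> eigenvalue A t"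
  shows "resolvent A t \<in> carrier_mat n n"
    and "resolvent A t * (A - t \<cdot>\<^sub>m 1\<^sub>m n) = 1\<^sub>m n"
    and "(A - t \<cdot>\<^sub>m 1\<^sub>m n) * resolvent A t = 1\<^sub>m n"
proof -
  let ?C = "A - t \<cdot>\<^sub>m 1\<^sub>m n"
  have C: "?C \<in> carrier_mat n n" using A by auto
  have eq: "char_matrix A t = ?C"
    using A by (intro eq_matI) (auto simp: char_matrix_def)
  have "det ?C \<noteq> 0" using t eigenvalue_det[OF A, of t] eq by auto
  then have "?C \<in> Units (ring_mat TYPE(complex) n ())"
    by (rule det_non_zero_imp_unit[OF C])
  then obtain Y where Y: "mat_inverse ?C = Some Y"
    using mat_inverse(1)[OF C, where b = "()"] by (cases "mat_inverse ?C") auto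
  have "resolvent A t = Y" using Y A by (auto simp: resolvent_def)
  then show "resolvent A t \<in> carrier_mat n n"
    "resolvent A t * ?C = 1\<^sub>m n" "?C * resolvent A t = 1\<^sub>m n"
    using mat_inverse(2)[OF C Y] by auto
qed

end

theory Submission
  imports Defs "HOL-Analysis.Function_Topology"
begin

text \<open>
  Eliminating the coordinates of the new oriented edges \<open>c \<rightarrow> n\<close> and \<open>n \<rightarrow> c\<close> from the
  equation \<open>B\<^sup>c y = t y\<close> leaves \<open>t\<^sup>2 (t v - B v) = X v\<close> for the restriction \<open>v\<close> of \<open>y\<close> to the edges
  of \<open>G\<close>: a walk that leaves \<open>G\<close> through \<open>c\<close> takes two extra steps, one into \<open>c\<close> and one out of it,
  and these contribute the factor \<open>t\<^sup>2\<close> (lemma \<open>eliminate_new_vertex\<close>). When \<open>t\<close> exceeds the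
  spectral radius of \<open>B\<close>, the resolvent \<open>Y\<close> at \<open>t\<close> exists and the equation reads
  \<open>Y X v = - t\<^sup>2 v\<close>. Both claims thus reduce to one: \<open>B\<^sup>c\<close> has a real eigenvalue above the Perron
  eigenvalue of \<open>B\<close>, with an eigenvector that does not vanish on the edges of \<open>G\<close>.

  This is strict monotonicity of the Perron eigenvalue. The matrix \<open>B\<^sup>c\<close> is nonnegative, and it is
  irreducible because every oriented edge of the extended graph can be joined to every other one by a
  non-backtracking walk (lemma \<open>nb_strongly_connected_add_vertex\<close>). The moduli of the entries of
  an eigenvector of \<open>B\<close> for \<open>\<mu>\<close>, extended by zero to the new edges, form a vector \<open>u \<ge> 0\<close> with
  \<open>B\<^sup>c u \<ge> \<mu> u\<close>. An irreducible nonnegative matrix has no nonnegative eigenvector with a zero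
  entry, so the inequality is strict somewhere; irreducibility spreads the slack to all entries
  and raises \<open>\<mu>\<close>, and the largest number reachable in this way is an eigenvalue with a
  positive eigenvector (lemma \<open>larger_eigenvalue\<close>).
\<close>

section \<open>Irreducible nonnegative matrices\<close>

text \<open>
  The entries of a matrix indexed by \<open>A\<close> are kept as a function, with its rows and columns
  outside \<open>A\<close> ignored. Irreducibility is stated as strong connectedness of the digraph of
  positive entries.
\<close>

locale irreducible_nonneg =
  fixes A :: "'b set" and M :: "'b \<Rightarrow> 'b \<Rightarrow> real"
  assumes finite_index: "finite A"
    and nonneg: "\<And>e f. e \<in> A \<Longrightarrow> f \<in> A \<Longrightarrow> 0 \<le> M e f"
    and irreducible: "\<And>e f. e \<in> A \<Longrightarrow> f \<in> A \<Longrightarrow>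
      (e, f) \<in> {(e, f). e \<in> A \<and> f \<in> A \<and> 0 < M e f}\<^sup>*"
begin

definition act :: "('b \<Rightarrow> real) \<Rightarrow> 'b \<Rightarrow> real" where
  "act x e = (\<Sum>f\<in>A. M e f * x f)"

text \<open>
  \<open>grow k\<close> is the matrix power \<open>(I + M)\<^sup>k\<close>. The summand \<open>I\<close>
  prevents entries that are already positive from becoming zero again, so that all entries become positive at
  the same time even if \<open>M\<close> is periodic.
\<close>

primrec grow :: "nat \<Rightarrow> ('b \<Rightarrow> real) \<Rightarrow> 'b \<Rightarrow> real" where
  "grow 0 x = x"
| "grow (Suc k) x = (\<lambda>e. grow k x e + act (grow k x) e)"

lemma act_add: "act (\<lambda>e. x e + y e) e = act x e + act y e"
  by (simp add: act_def algebra_simps sum.distrib)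

lemma act_diff: "act (\<lambda>e. x e - y e) e = act x e - act y e"
  by (simp add: act_def algebra_simps sum_subtractf)

lemma act_scale: "act (\<lambda>e. a * x e) e = a * act x e"
  by (simp add: act_def algebra_simps sum_distrib_left)

lemma act_cong: "(\<And>f. f \<in> A \<Longrightarrow> x f = y f) \<Longrightarrow> act x e = act y e"
  by (simp add: act_def)

lemma act_nonneg:
  assumes "\<And>f. f \<in> A \<Longrightarrow> 0 \<le> x f" and "e \<in> A"
  shows "0 \<le> act x e"
  unfolding act_def using assms nonneg by (intro sum_nonneg) auto

lemma act_pos:
  assumes "\<And>f. f \<in> A \<Longrightarrow> 0 \<le> x f" and "e \<in> A" "f \<in> A" "0 < M e f" "0 < x f"
  shows "0 < act x e"
  unfolding act_def
  using assms nonneg finite_index by (intro sum_pos2[of A f]) auto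

lemma grow_nonneg:
  assumes "\<And>f. f \<in> A \<Longrightarrow> 0 \<le> x f" and "e \<in> A"
  shows "0 \<le> grow k x e"
  using assms(2) by (induction k arbitrary: e) (auto simp: assms(1) act_nonneg)

lemma grow_pos_mono:
  assumes x: "\<And>f. f \<in> A \<Longrightarrow> 0 \<le> x f" and e: "e \<in> A" and "0 < grow j x e" and "j \<le> k"
  shows "0 < grow k x e"
  using \<open>j \<le> k\<close>
proof (induction k rule: dec_induct)
  case (step n)
  have "0 \<le> act (grow n x) e" using x e by (intro act_nonneg grow_nonneg)
  then show ?case using step by simp
qed (use assms in simp)

text \<open>
  Positivity travels backwards along the positive entries of \<open>M\<close>, one edge per application of
  \<open>I + M\<close>, so by irreducibility it reaches each index, and it stays there.
\<close>

lemma grow_eventually_pos: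
  assumes x: "\<And>f. f \<in> A \<Longrightarrow> 0 \<le> x f" and f: "f \<in> A" "0 < x f"
  shows "\<exists>K. \<forall>k\<ge>K. \<forall>e\<in>A. 0 < grow k x e"
proof -
  have "\<exists>k. 0 < grow k x e" if e: "e \<in> A" for e
    using irreducible[OF e f(1)]
  proof (induction rule: converse_rtrancl_induct)
    case base
    show ?case using f by (intro exI[of _ 0]) simp
  next
    case (step e e')
    then obtain k where "0 < grow k x e'" by blast
    then have "0 < act (grow k x) e"
      using step x by (intro act_pos[of _ e e']) (auto intro: grow_nonneg)
    moreover have "0 \<le> grow k x e" using step x by (auto intro: grow_nonneg)
    ultimately show ?case by (intro exI[of _ "Suc k"]) simp
  qed
  then obtain K where K: "\<And>e. e \<in> A \<Longrightarrow> 0 < grow (K e) x e" by metis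
  have "0 < grow k x e" if "k \<ge> Max (K ` A)" "e \<in> A" for k e
  proof -
    have "K e \<le> Max (K ` A)" using finite_index that by (intro Max_ge) auto
    with that show ?thesis by (intro grow_pos_mono[OF x _ K, of e k]) auto
  qed
  then show ?thesis by blast
qed

text \<open>
  \<open>M - s I\<close> commutes with \<open>(I + M)\<^sup>k\<close>.
\<close>

lemma grow_defect:
  "act (grow k x) e - s * grow k x e = grow k (\<lambda>e. act x e - s * x e) e"
proof (induction k arbitrary: e)
  case (Suc k)
  let ?y = "grow k x"
  have "act (grow (Suc k) x) e - s * grow (Suc k) x e
      = (act ?y e - s * ?y e) + act (\<lambda>e. act ?y e - s * ?y e) e"
    by (simp add: act_add act_diff act_scale algebra_simps)
  then show ?case by (simp add: Suc)
qed simp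

text \<open>
  \<open>(I + M)\<^sup>k x = (1 + r)\<^sup>k x\<close> has the same zero entries as \<open>x\<close> or
  vanishes, and for large \<open>k\<close> all its entries are positive.
\<close>

lemma nonneg_eigenvector_pos:
  assumes x: "\<And>f. f \<in> A \<Longrightarrow> 0 \<le> x f" and f: "f \<in> A" "0 < x f"
    and eig: "\<And>e. e \<in> A \<Longrightarrow> act x e = r * x e" and e: "e \<in> A"
  shows "0 < x e"
proof -
  have pow: "grow k x e = (1 + r) ^ k * x e" if "e \<in> A" for k e
    using that
  proof (induction k arbitrary: e)
    case (Suc k)
    have "act (grow k x) e = act (\<lambda>f. (1 + r) ^ k * x f) e" using Suc by (intro act_cong)
    also have "\<dots> = (1 + r) ^ k * (r * x e)" using Suc eig by (simp only: act_scale)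
    finally show ?case using Suc by (simp add: algebra_simps)
  qed simp
  obtain k where "0 < grow k x e" using grow_eventually_pos[of x f, OF x f] e by blast
  then have "x e \<noteq> 0" using pow[OF e] by auto
  then show ?thesis using x[OF e] by simp
qed

text \<open>
  Applying \<open>(I + M)\<^sup>k\<close> to \<open>x\<close> applies it to the defect
  \<open>M x - s x \<ge> 0\<close> as well, which is not zero. For large \<open>k\<close> the new vector and
  the new defect are therefore positive everywhere, which leaves room to increase \<open>s\<close>.
\<close>

lemma subeigenvector_improve:
  assumes x: "\<And>f. f \<in> A \<Longrightarrow> 0 \<le> x f" and f: "f \<in> A" "0 < x f"
    and sub: "\<And>e. e \<in> A \<Longrightarrow> s * x e \<le> act x e"
    and strict: "g \<in> A" "act x g \<noteq> s * x g"
  shows "\<exists>s' y. s < s' \<and> (\<forall>e\<in>A. 0 < y e \<and> s' * y e \<le> act y e)"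
proof -
  let ?D = "\<lambda>e. act x e - s * x e"
  obtain K1 where K1: "\<And>k e. k \<ge> K1 \<Longrightarrow> e \<in> A \<Longrightarrow> 0 < grow k x e"
    using grow_eventually_pos[of x f, OF x f] by blast
  obtain K2 where K2: "\<And>k e. k \<ge> K2 \<Longrightarrow> e \<in> A \<Longrightarrow> 0 < grow k ?D e"
  proof -
    have "0 < ?D g" using sub[OF strict(1)] strict(2) by simp
    then show thesis using grow_eventually_pos[of ?D g] sub strict(1) that by auto
  qed
  let ?k = "max K1 K2"
  define y where "y = grow ?k x"
  define w where "w = grow ?k ?D"
  define d where "d = Min ((\<lambda>e. w e / y e) ` A)"
  have y: "0 < y e" and w: "0 < w e" if "e \<in> A" for e
    using K1[of ?k e] K2[of ?k e] that by (auto simp: y_def w_def)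
  have "0 < d"
    unfolding d_def using finite_index strict(1) y w by (subst Min_gr_iff) auto
  moreover have "(s + d) * y e \<le> act y e" if e: "e \<in> A" for e
  proof -
    have "d \<le> w e / y e" unfolding d_def using e finite_index by (intro Min_le) auto
    then have "d * y e \<le> w e" using y[OF e] by (simp add: field_simps)
    moreover have "act y e - s * y e = w e" unfolding y_def w_def by (rule grow_defect)
    ultimately show ?thesis by (simp add: algebra_simps)
  qed
  ultimately show ?thesis using y by (intro exI[of _ "s + d"] exI[of _ y]) auto
qed

text \<open>
  The sum is fixed to 1 so that the feasible vectors form a compact set; the largest feasible \<open>s\<close>
  is the Collatz-Wielandt number of the matrix.
\<close>

definition feasible :: "real \<Rightarrow> ('b \<Rightarrow> real) \<Rightarrow> bool" where
  "feasible s x \<longleftrightarrow> (\<forall>e\<in>A. 0 \<le> x e) \<and> (\<Sum>e\<in>A. x e) = 1 \<and> (\<forall>e\<in>A. s * x e \<le> act x e)"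

lemma feasible_normalize:
  assumes x: "\<And>f. f \<in> A \<Longrightarrow> 0 \<le> x f" and f: "f \<in> A" "0 < x f"
    and sub: "\<And>e. e \<in> A \<Longrightarrow> s * x e \<le> act x e"
  shows "feasible s (\<lambda>e. x e / (\<Sum>e\<in>A. x e))"
proof -
  let ?S = "\<Sum>e\<in>A. x e"
  have S: "0 < ?S" using x f finite_index by (intro sum_pos2[of A f]) auto
  have "act (\<lambda>e. x e / ?S) e = act x e / ?S" for e
    using act_scale[of "1 / ?S" x e] by simp
  then show ?thesis
    using S x sub by (auto simp: feasible_def divide_right_mono simp flip: sum_divide_distrib)
qed

lemma feasible_le1: "feasible s x \<Longrightarrow> e \<in> A \<Longrightarrow> x e \<le> 1"
  using member_le_sum[of e A x] finite_index by (auto simp: feasible_def)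

lemma feasible_bound:
  assumes "feasible s x"
  shows "s \<le> (\<Sum>e\<in>A. \<Sum>f\<in>A. M e f)"
proof -
  have "s = (\<Sum>e\<in>A. s * x e)" using assms by (simp add: feasible_def flip: sum_distrib_left)
  also have "\<dots> \<le> (\<Sum>e\<in>A. act x e)" using assms by (intro sum_mono) (simp add: feasible_def)
  also have "\<dots> \<le> (\<Sum>e\<in>A. \<Sum>f\<in>A. M e f)"
    unfolding act_def
    using feasible_le1[OF assms] nonneg by (intro sum_mono) (simp add: mult_left_le)
  finally show ?thesis .
qed

text \<open>
  The pairs \<open>(s, x)\<close> form a closed subset of a product of compact intervals, where
  \<open>s\<close> attains its maximum. Coordinates outside \<open>A\<close> are pinned to 0, which makes the
  space of functions on the whole type compact by Tychonoff's theorem.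
\<close>

lemma feasible_max:
  assumes start: "feasible s\<^sub>0 x\<^sub>0"
  shows "\<exists>r x. feasible r x \<and> (\<forall>s y. feasible s y \<longrightarrow> s \<le> r)"
proof -
  let ?R = "\<Sum>e\<in>A. \<Sum>f\<in>A. M e f"
  let ?cube = "Pi\<^sub>E UNIV (\<lambda>e. if e \<in> A then {0..1} else {0::real})"
  define C where "C = ({s\<^sub>0..?R} \<times> ?cube) \<inter> {p. (\<Sum>e\<in>A. snd p e) = 1}
    \<inter> (\<Inter>e\<in>A. {p. fst p * snd p e \<le> (\<Sum>f\<in>A. M e f * snd p f)})"
  have "compact ?cube"
    using compactin_PiE[of "\<lambda>_. euclidean" UNIV "\<lambda>e. if e \<in> A then {0..1} else {0::real}"]
    by (simp add: euclidean_product_topology)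
  moreover have coord: "continuous_on UNIV (\<lambda>p :: real \<times> ('b \<Rightarrow> real). snd p e)" for e
    by (rule continuous_on_product_then_coordinatewise) (intro continuous_intros)
  ultimately have "compact C"
    unfolding C_def
    by (intro compact_Int_closed closed_INT ballI compact_Times closed_Collect_eq closed_Collect_le
        continuous_intros coord) auto
  have feas_C: "feasible (fst p) (snd p)" if "p \<in> C" for p
  proof -
    have "snd p e \<in> {0..1}" if "e \<in> A" for e
      using \<open>p \<in> C\<close> that by (auto simp: C_def PiE_iff split: if_splits)
    then show ?thesis using that by (auto simp: C_def feasible_def act_def)
  qed
  have C_feas: "(s, \<lambda>e. if e \<in> A then y e else 0) \<in> C" if "feasible s y" "s\<^sub>0 \<le> s" for s y
    using that feasible_bound[OF that(1)] feasible_le1[OF that(1)]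
    by (auto simp: C_def feasible_def act_def)
  have "C \<noteq> {}" using C_feas[OF start] by auto
  then obtain p where p: "p \<in> C" "\<And>q. q \<in> C \<Longrightarrow> fst q \<le> fst p"
    using continuous_attains_sup[OF \<open>compact C\<close> _ continuous_on_fst[OF continuous_on_id]] by blast
  have "s\<^sub>0 \<le> fst p" using p(1) by (auto simp: C_def)
  then have "s \<le> fst p" if "feasible s y" for s y
    using p(2)[OF C_feas[OF that]] by (cases "s\<^sub>0 \<le> s") auto
  then show ?thesis using feas_C[OF p(1)] by blast
qed

text \<open>
  The zero entry prevents \<open>x\<close> from being an eigenvector, so \<open>s\<close> can be improved
  once; hence the Collatz-Wielandt number is larger than \<open>s\<close>. A vector that attains it is an
  eigenvector, since otherwise it could be improved further.
\<close>

lemma larger_eigenvalue: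
  assumes x: "\<And>f. f \<in> A \<Longrightarrow> 0 \<le> x f" and f: "f \<in> A" "0 < x f"
    and sub: "\<And>e. e \<in> A \<Longrightarrow> s * x e \<le> act x e"
    and zero: "g \<in> A" "x g = 0"
  shows "\<exists>r y. s < r \<and> (\<forall>e\<in>A. 0 < y e \<and> act y e = r * y e)"
proof -
  have "\<exists>e\<in>A. act x e \<noteq> s * x e"
    using nonneg_eigenvector_pos[of x f s g, OF x f _ zero(1)] zero(2) by fastforce
  then obtain s' y where s': "s < s'" and y: "\<forall>e\<in>A. 0 < y e \<and> s' * y e \<le> act y e"
    using subeigenvector_improve[of x f s, OF x f sub] by blast
  have "feasible s' (\<lambda>e. y e / (\<Sum>e\<in>A. y e))"
    using y f(1) by (intro feasible_normalize[of y f]) (auto intro: less_imp_le)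
  then obtain r z where z: "feasible r z" and max: "\<And>s y. feasible s y \<Longrightarrow> s \<le> r" and "s' \<le> r"
    using feasible_max by blast
  have z0: "\<And>e. e \<in> A \<Longrightarrow> 0 \<le> z e" and zr: "\<And>e. e \<in> A \<Longrightarrow> r * z e \<le> act z e"
    using z by (auto simp: feasible_def)
  obtain h where h: "h \<in> A" "0 < z h"
    using z sum_nonpos[of A z] by (force simp: feasible_def not_less)
  have eig: "act z e = r * z e" if e: "e \<in> A" for e
  proof (rule ccontr)
    assume "act z e \<noteq> r * z e"
    then obtain t w where t: "r < t" and w: "\<forall>e\<in>A. 0 < w e \<and> t * w e \<le> act w e"
      using subeigenvector_improve[of z h r e, OF z0 h zr e] by blast
    have "feasible t (\<lambda>e. w e / (\<Sum>e\<in>A. w e))"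
      using w f(1) by (intro feasible_normalize[of w f]) (auto intro: less_imp_le)
    then show False using max t by fastforce
  qed
  show ?thesis
    using nonneg_eigenvector_pos[of z h r, OF z0 h eig] eig s' \<open>s' \<le> r\<close> by (intro exI[of _ r] exI[of _ z]) auto
qed

end

section \<open>Non-backtracking walks\<close>

definition nb_next :: "('a \<times> 'a) set \<Rightarrow> (('a \<times> 'a) \<times> ('a \<times> 'a)) set" where
  "nb_next E = {((u, v), (v', w)). (u, v) \<in> E \<and> (v', w) \<in> E \<and> v' = v \<and> u \<noteq> w}"

lemma nb_nextI: "(u, v) \<in> E \<Longrightarrow> (v, w) \<in> E \<Longrightarrow> u \<noteq> w \<Longrightarrow> ((u, v), (v, w)) \<in> nb_next E"
  by (simp add: nb_next_def)

lemma nb_next_mono: "E \<subseteq> F \<Longrightarrow> nb_next E \<subseteq> nb_next F"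
  by (auto simp: nb_next_def)

lemma nb_reach_in: "(e, f) \<in> (nb_next E)\<^sup>* \<Longrightarrow> e \<in> E \<Longrightarrow> f \<in> E"
  by (induction rule: rtrancl_induct) (auto simp: nb_next_def)

lemma nb_reach_swap:
  assumes "sym E" and "(e, f) \<in> (nb_next E)\<^sup>*"
  shows "(prod.swap f, prod.swap e) \<in> (nb_next E)\<^sup>*"
  using assms(2)
proof (induction rule: rtrancl_induct)
  case (step f g)
  have "(prod.swap g, prod.swap f) \<in> nb_next E"
    using step(2) symD[OF assms(1)] by (auto simp: nb_next_def)
  then show ?case using step(3) by (rule converse_rtrancl_into_rtrancl)
qed simp

text \<open>
  If a walk that starts with the edge \<open>(a, b)\<close> could not come back to \<open>a\<close>, the
  reversal of the initial edge would not be reached, and this property is inherited along the walk: no reached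
  edge has a reached reversal. So no vertex is the head of two reached edges (a walk arriving by one of them
  could continue into the reversal of the other). Then a choice of a continuation for each reached edge is an
  injective map on the finite set of reached edges; being surjective, it hits the initial edge, whose tail
  \<open>a\<close> is therefore the head of a reached edge.
\<close>

lemma nb_reach_tail:
  assumes fin: "finite E" and sym: "sym E"
    and deg: "\<And>v w. v \<in> Range E \<Longrightarrow> \<exists>x. (v, x) \<in> E \<and> x \<noteq> w"
    and ab: "(a, b) \<in> E"
  shows "\<exists>u. ((a, b), (u, a)) \<in> (nb_next E)\<^sup>*"
proof (rule ccontr)
  assume contra: "\<not> ?thesis"
  define R where "R = {f. ((a, b), f) \<in> (nb_next E)\<^sup>*}"
  have RE: "R \<subseteq> E" using nb_reach_in[OF _ ab] by (auto simp: R_def)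
  have onward: "(v, w) \<in> R" if "(u, v) \<in> R" "(v, w) \<in> E" "u \<noteq> w" for u v w
    using that RE nb_nextI[of u v E w] unfolding R_def by (auto intro: rtrancl_into_rtrancl)
  have one_way: "prod.swap f \<notin> R" if "((a, b), f) \<in> (nb_next E)\<^sup>*" for f
    using that
  proof (induction rule: rtrancl_induct)
    case base
    show ?case using contra by (auto simp: R_def)
  next
    case (step f g)
    obtain u v w where f: "f = (u, v)" and g: "g = (v, w)" and uw: "u \<noteq> w" and uv: "(u, v) \<in> E"
      using step(2) by (auto simp: nb_next_def)
    \<comment> \<open>After the step from \<open>w\<close> to \<open>v\<close> the walk may turn to \<open>u\<close>, since \<open>u \<noteq> w\<close>.\<close>
    have "(w, v) \<in> R \<Longrightarrow> (v, u) \<in> R"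
      using onward symD[OF sym uv] uw by blast
    then show ?case using step(3) f g by auto
  qed
  have head_inj: "u = u'" if "(u, v) \<in> R" "(u', v) \<in> R" for u u' v
  proof (rule ccontr)
    assume "u \<noteq> u'"
    moreover have "(v, u) \<in> E" using that(1) RE sym by (auto dest: symD)
    ultimately have "(v, u) \<in> R" using onward[OF that(2)] by blast
    then show False using one_way[of "(u, v)"] that(1) by (simp add: R_def)
  qed
  have "\<exists>w. (snd f, w) \<in> R" if "f \<in> R" for f
    using deg[of "snd f" "fst f"] onward[of "fst f" "snd f"] that RE by (cases f) fastforce
  then obtain s where s: "\<And>f. f \<in> R \<Longrightarrow> (snd f, s f) \<in> R" by metis
  have "inj_on (\<lambda>f. (snd f, s f)) R"
    using head_inj by (intro inj_onI) (auto simp: prod_eq_iff)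
  moreover have "(\<lambda>f. (snd f, s f)) ` R \<subseteq> R" using s by auto
  ultimately have "(\<lambda>f. (snd f, s f)) ` R = R"
    using finite_subset[OF RE fin] by (intro endo_inj_surj)
  moreover have "(a, b) \<in> R" by (simp add: R_def)
  ultimately have "(a, b) \<in> (\<lambda>f. (snd f, s f)) ` R" by simp
  then obtain u where "(u, a) \<in> R" by auto
  then show False using contra by (auto simp: R_def)
qed

text \<open>
  The set of heads of reached edges is closed under adjacency. A walk arriving at \<open>v\<close> may go on
  to each neighbour \<open>w\<close> except the vertex it came from, and that vertex was itself visited as a
  head before, unless the walk consists of the initial edge only. In that case \<open>w = a\<close>, which
  \<open>nb_reach_tail\<close> takes care of.
\<close>

lemma nb_reach_every_vertex:
  assumes fin: "finite E" and sym: "sym E"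
    and deg: "\<And>v w. v \<in> Range E \<Longrightarrow> \<exists>x. (v, x) \<in> E \<and> x \<noteq> w"
    and ab: "(a, b) \<in> E" and conn: "(b, v) \<in> E\<^sup>*"
  shows "\<exists>u. ((a, b), (u, v)) \<in> (nb_next E)\<^sup>*"
  using conn
proof (induction rule: rtrancl_induct)
  case (step v w)
  then obtain u where u: "((a, b), (u, v)) \<in> (nb_next E)\<^sup>*" by blast
  have uv: "(u, v) \<in> E" using nb_reach_in[OF u ab] .
  consider "w = a" | "w \<noteq> u" | "w = u" "u \<noteq> a" by blast
  then show ?case
  proof cases
    case 1
    then show ?thesis using nb_reach_tail[OF fin sym deg ab] by blast
  next
    case 2
    then show ?thesis using u nb_nextI[OF uv step(2)] by (blast intro: rtrancl_into_rtrancl)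
  next
    case 3
    from u show ?thesis
    proof (cases rule: rtranclE)
      case base
      then show ?thesis using 3 by simp
    next
      case (step g)
      then show ?thesis using 3 by (auto simp: nb_next_def)
    qed
  qed
qed blast

text \<open>
  From an edge of \<open>E\<close> a walk reaches every vertex of \<open>N\<close>, can step to
  \<open>c\<close> there, and leave \<open>c\<close> to any other vertex of \<open>N\<close>. Two elements of
  \<open>N\<close> allow the walk to enter \<open>c\<close> from one of them and leave to the other, and so
  every edge out of \<open>c\<close> is reached from everywhere. Reversing walks, every edge is reached from
  each edge into \<open>c\<close>. The detour through \<open>c\<close> also joins edges that no walk within
  \<open>E\<close> connects, such as edges of opposite directions on a cycle.
\<close>

lemma nb_strongly_connected_add_vertex:
  fixes E :: "('a \<times> 'a) set" and c :: 'a and N :: "'a set"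
  defines "F \<equiv> E \<union> {c} \<times> N \<union> N \<times> {c}"
  assumes fin: "finite E" and sym: "sym E"
    and deg: "\<And>v w. v \<in> Range E \<Longrightarrow> \<exists>x. (v, x) \<in> E \<and> x \<noteq> w"
    and conn: "\<And>u v n. (u, v) \<in> E \<Longrightarrow> n \<in> N \<Longrightarrow> (v, n) \<in> E\<^sup>*"
    and c: "c \<notin> Field E" and N: "N \<subseteq> Domain E"
    and two: "\<And>m. \<exists>n\<in>N. n \<noteq> m"
    and e: "e \<in> F" and f: "f \<in> F"
  shows "(e, f) \<in> (nb_next F)\<^sup>*"
proof -
  have symF: "sym F" using sym by (auto simp: F_def sym_def)
  have lift: "(nb_next E)\<^sup>* \<subseteq> (nb_next F)\<^sup>*"
    by (intro rtrancl_mono nb_next_mono) (auto simp: F_def)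
  have to_c: "(g, (n, c)) \<in> (nb_next F)\<^sup>*" if "g \<in> E" "n \<in> N" for g n
  proof -
    obtain a b where g: "g = (a, b)" by (cases g)
    have "\<exists>u. ((a, b), (u, n)) \<in> (nb_next E)\<^sup>*"
      using that g conn by (intro nb_reach_every_vertex[OF fin sym deg]) auto
    then obtain u where u: "(g, (u, n)) \<in> (nb_next E)\<^sup>*" using g by blast
    have "(u, n) \<in> E" using nb_reach_in[OF u that(1)] .
    moreover from this have "u \<noteq> c" using c by (auto simp: Field_def)
    ultimately have "((u, n), (n, c)) \<in> nb_next F"
      using that by (intro nb_nextI) (auto simp: F_def)
    with u lift show ?thesis by (blast intro: rtrancl_into_rtrancl)
  qed
  have turn: "((m, c), (c, n)) \<in> nb_next F" if "m \<in> N" "n \<in> N" "m \<noteq> n" for m n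
    using that by (intro nb_nextI) (auto simp: F_def)
  have from_c: "((c, m), (c, n)) \<in> (nb_next F)\<^sup>*" if m: "m \<in> N" and n: "n \<in> N" for m n
  proof -
    obtain x where x: "(m, x) \<in> E" using N m by blast
    then have "x \<noteq> c" using c by (auto simp: Field_def)
    then have "((c, m), (m, x)) \<in> nb_next F"
      using m x by (intro nb_nextI) (auto simp: F_def)
    moreover obtain k where k: "k \<in> N" "k \<noteq> n" using two by blast
    ultimately show ?thesis
      using to_c[OF x k(1)] turn[OF k(1) n k(2)]
      by (meson converse_rtrancl_into_rtrancl rtrancl_into_rtrancl)
  qed
  have reach_c: "(g, (c, n)) \<in> (nb_next F)\<^sup>*" if g: "g \<in> F" and n: "n \<in> N" for g n
  proof -
    obtain k where k: "k \<in> N" "k \<noteq> n" using two by blast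
    consider "g \<in> E" | m where "g = (c, m)" "m \<in> N" | m where "g = (m, c)" "m \<in> N"
      using g by (auto simp: F_def)
    then show ?thesis
    proof cases
      case 1
      show ?thesis using to_c[OF 1 k(1)] turn[OF k(1) n k(2)] by (rule rtrancl_into_rtrancl)
    next
      case 2
      then show ?thesis using from_c n by simp
    next
      case (3 m)
      obtain m' where "m' \<in> N" "m' \<noteq> m" using two by blast
      then show ?thesis using turn[of m m'] from_c[of m' n] 3 n
        by (auto intro: converse_rtrancl_into_rtrancl)
    qed
  qed
  obtain n where n: "n \<in> N" using two by blast
  obtain n' where n': "n' \<in> N" "n' \<noteq> n" using two by blast
  have "prod.swap f \<in> F" using f symF by (cases f) (auto dest: symD)
  from nb_reach_swap[OF symF reach_c[OF this n]] have "((n, c), f) \<in> (nb_next F)\<^sup>*" by simp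
  moreover have "(e, (n, c)) \<in> (nb_next F)\<^sup>*"
  proof -
    obtain x where x: "(n', x) \<in> E" using N n'(1) by blast
    then have "x \<noteq> c" using c by (auto simp: Field_def)
    then have "((c, n'), (n', x)) \<in> nb_next F"
      using n' x by (intro nb_nextI) (auto simp: F_def)
    then show ?thesis using reach_c[OF e n'(1)] to_c[OF x n] by (meson rtrancl_trans r_into_rtrancl)
  qed
  ultimately show ?thesis by (rule rtrancl_trans[rotated])
qed

section \<open>Matrices indexed by a list\<close>

definition indexed_vec :: "'b list \<Rightarrow> ('b \<Rightarrow> complex) \<Rightarrow> complex vec" where
  "indexed_vec es v = vec (length es) (\<lambda>r. v (es ! r))"

lemma indexed_vec_carrier [simp]: "indexed_vec es v \<in> carrier_vec (length es)"
  by (simp add: indexed_vec_def)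

lemma indexed_mat_carrier [simp]: "indexed_mat es F \<in> carrier_mat (length es) (length es)"
  by (simp add: indexed_mat_def)

lemma indexed_vec_eq_iff: "indexed_vec es v = indexed_vec es w \<longleftrightarrow> (\<forall>e\<in>set es. v e = w e)"
  by (simp add: indexed_vec_def vec_eq_iff all_set_conv_all_nth)

lemma zero_vec_indexed: "0\<^sub>v (length es) = indexed_vec es (\<lambda>_. 0)"
  by (auto simp: indexed_vec_def)

lemma smult_indexed_vec: "a \<cdot>\<^sub>v indexed_vec es v = indexed_vec es (\<lambda>e. a * v e)"
  by (auto simp: indexed_vec_def)

lemma diff_indexed_vec: "indexed_vec es v - indexed_vec es w = indexed_vec es (\<lambda>e. v e - w e)"
  by (auto simp: indexed_vec_def)

lemma indexed_mat_mult_vec: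
  assumes "distinct es"
  shows "indexed_mat es F *\<^sub>v indexed_vec es v = indexed_vec es (\<lambda>e. \<Sum>f\<in>set es. F e f * v f)"
proof -
  have "(\<Sum>j<length es. F e (es ! j) * v (es ! j)) = (\<Sum>f\<in>set es. F e f * v f)" for e
    using bij_betw_nth[OF assms refl refl] by (intro sum.reindex_bij_betw)
  then show ?thesis
    by (auto simp: indexed_mat_def indexed_vec_def scalar_prod_def atLeast0LessThan)
qed

text \<open>
  Every vector is the list of values of some function, because the entries of the list are distinct.
\<close>

lemma carrier_vec_indexed:
  assumes "distinct es" "w \<in> carrier_vec (length es)"
  obtains v where "w = indexed_vec es v"
proof
  let ?i = "inv_into {..<length es} ((!) es)"
  show "w = indexed_vec es (\<lambda>e. w $ ?i e)"
    using assms by (intro eq_vecI) (auto simp: indexed_vec_def inv_into_f_f inj_on_nth)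
qed

lemma eigenvalue_indexed_mat_iff:
  assumes "distinct es"
  shows "eigenvalue (indexed_mat es F) t \<longleftrightarrow>
    (\<exists>v. (\<exists>e\<in>set es. v e \<noteq> 0) \<and> (\<forall>e\<in>set es. (\<Sum>f\<in>set es. F e f * v f) = t * v e))"
proof -
  have dim: "dim_row (indexed_mat es F) = length es" by (simp add: indexed_mat_def)
  have *: "eigenvector (indexed_mat es F) (indexed_vec es v) t \<longleftrightarrow>
    (\<exists>e\<in>set es. v e \<noteq> 0) \<and> (\<forall>e\<in>set es. (\<Sum>f\<in>set es. F e f * v f) = t * v e)" for v
    by (simp add: eigenvector_def dim indexed_mat_mult_vec[OF assms] smult_indexed_vec
        zero_vec_indexed indexed_vec_eq_iff)
  show ?thesis
    unfolding eigenvalue_def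
  proof (intro iffI; elim exE)
    fix w assume w: "eigenvector (indexed_mat es F) w t"
    then have "w \<in> carrier_vec (length es)" by (simp add: eigenvector_def dim)
    then obtain v where "w = indexed_vec es v" using carrier_vec_indexed[OF assms] by blast
    then show "\<exists>v. (\<exists>e\<in>set es. v e \<noteq> 0) \<and> (\<forall>e\<in>set es. (\<Sum>f\<in>set es. F e f * v f) = t * v e)"
      using w * by blast
  qed (use * in blast)
qed

text \<open>
  The hypothesis on \<open>v\<close> is the generalised eigenvalue equation
  \<open>X v = s (B - t I) v\<close>, which the resolvent turns into an ordinary one.
\<close>

lemma eigenvalue_resolvent_mult:
  assumes B: "B \<in> carrier_mat n n" and X: "X \<in> carrier_mat n n" and t: "\<not> eigenvalue B t"
    and v: "v \<in> carrier_vec n" "v \<noteq> 0\<^sub>v n"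
    and eq: "X *\<^sub>v v = s \<cdot>\<^sub>v (B *\<^sub>v v - t \<cdot>\<^sub>v v)"
  shows "eigenvalue (resolvent B t * X) s"
proof -
  let ?Y = "resolvent B t" and ?C = "B - t \<cdot>\<^sub>m 1\<^sub>m n"
  note Y = resolvent_inverse[OF B t]
  have C: "?C \<in> carrier_mat n n" using B by auto
  have "(t \<cdot>\<^sub>m 1\<^sub>m n) *\<^sub>v v = t \<cdot>\<^sub>v v" using v by (intro eq_vecI) auto
  then have "B *\<^sub>v v - t \<cdot>\<^sub>v v = ?C *\<^sub>v v"
    using B v by (simp add: minus_mult_distrib_mat_vec[of B n n])
  then have "(?Y * X) *\<^sub>v v = ?Y *\<^sub>v (s \<cdot>\<^sub>v (?C *\<^sub>v v))"
    using Y X v by (simp add: eq assoc_mult_mat_vec[of _ n n _ n])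
  also have "\<dots> = s \<cdot>\<^sub>v (?Y *\<^sub>v (?C *\<^sub>v v))"
    using Y C v by (intro mult_mat_vec[of _ n n]) auto
  also have "?Y *\<^sub>v (?C *\<^sub>v v) = (?Y * ?C) *\<^sub>v v"
    using Y(1) C v(1) by (rule assoc_mult_mat_vec[symmetric])
  also have "\<dots> = v" unfolding Y(2) using v by simp
  finally have "eigenvector (?Y * X) v s"
    using Y X v by (auto simp: eigenvector_def)
  then show ?thesis unfolding eigenvalue_def by blast
qed

lemma not_eigenvalue_above_spectral_radius:
  assumes B: "B \<in> carrier_mat n n" and t: "spectral_radius B < norm t"
  shows "\<not> eigenvalue B t"
proof
  assume e: "eigenvalue B t"
  then have "n \<noteq> 0" using B by (auto simp: eigenvalue_def eigenvector_def)
  then show False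
    using spectral_radius_mem_max(2)[OF B, of "norm t"] e t by (auto simp: spectrum_def)
qed

section \<open>Eliminating the edges at the new vertex\<close>

definition nb_weight :: "'a \<times> 'a \<Rightarrow> 'a \<times> 'a \<Rightarrow> real" where
  "nb_weight e f = (if snd f = fst e \<and> fst f \<noteq> snd e then 1 else 0)"

lemma nb_entry_eq_weight: "nb_entry e f = of_real (nb_weight e f)"
  by (cases e; cases f) (auto simp: nb_entry_def nb_weight_def kdelta_def)

text \<open>
  Rows of the matrix are indexed by the later edge of a step and columns by the earlier one, hence the
  converse.
\<close>

lemma nb_weight_support: "{(e, f). e \<in> F \<and> f \<in> F \<and> 0 < nb_weight e f} = (nb_next F)\<inverse>"
  by (auto simp: nb_next_def nb_weight_def)

text \<open>
  The eigenvalue equation is used at three kinds of edges: at the edge \<open>(k, l)\<close> of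
  \<open>E\<close>, whose predecessors are edges of \<open>E\<close> and, if \<open>k \<in> N\<close>, the
  edge \<open>(c, k)\<close>; at \<open>(c, k)\<close>, preceded by the edges \<open>(n, c)\<close> with
  \<open>n \<noteq> k\<close>; and at \<open>(n, c)\<close>, preceded by the edges of \<open>E\<close> into
  \<open>n\<close>. Substituting each of the last two costs a factor \<open>t\<close>.
\<close>

lemma eliminate_new_vertex:
  fixes E :: "('a \<times> 'a) set" and c :: 'a and N :: "'a set" and x :: "'a \<times> 'a \<Rightarrow> real"
  defines "F \<equiv> E \<union> {c} \<times> N \<union> N \<times> {c}"
  assumes fin: "finite E" "finite N" and c: "c \<notin> Field E" "c \<notin> N"
    and eig: "\<And>e. e \<in> F \<Longrightarrow> (\<Sum>f\<in>F. nb_weight e f * x f) = t * x e"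
    and kl: "(k, l) \<in> E"
  shows "t\<^sup>2 * (t * x (k, l) - (\<Sum>f\<in>E. nb_weight (k, l) f * x f))
    = (\<Sum>f\<in>E. if k \<in> N \<and> snd f \<in> N \<and> snd f \<noteq> k then x f else 0)"
proof -
  have ends: "u \<noteq> c \<and> v \<noteq> c" if "(u, v) \<in> E" for u v
    using that c by (auto simp: Field_def)
  have mem_new: "(c, n) \<in> F" "(n, c) \<in> F" if "n \<in> N" for n
    using that by (auto simp: F_def)
  have split: "(\<Sum>f\<in>F. g f) = (\<Sum>f\<in>E. g f) + (\<Sum>n\<in>N. g (c, n)) + (\<Sum>n\<in>N. g (n, c))"
    for g :: "'a \<times> 'a \<Rightarrow> real"
  proof -
    have "(\<Sum>f\<in>F. g f) = (\<Sum>f\<in>E. g f) + (\<Sum>f\<in>{c} \<times> N. g f) + (\<Sum>f\<in>N \<times> {c}. g f)"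
      unfolding F_def using fin c ends
      by (subst sum.union_disjoint; (subst sum.union_disjoint)?) auto
    moreover have "(\<Sum>f\<in>{c} \<times> N. g f) = (\<Sum>n\<in>N. g (c, n))"
      by (rule sum.reindex_bij_witness[of _ "Pair c" snd]) auto
    moreover have "(\<Sum>f\<in>N \<times> {c}. g f) = (\<Sum>n\<in>N. g (n, c))"
      by (rule sum.reindex_bij_witness[of _ "\<lambda>n. (n, c)" fst]) auto
    ultimately show ?thesis by simp
  qed
  have tail: "t * x (k, l) = (\<Sum>f\<in>E. nb_weight (k, l) f * x f) + (if k \<in> N then x (c, k) else 0)"
  proof -
    have "(\<Sum>n\<in>N. nb_weight (k, l) (c, n) * x (c, n)) = (\<Sum>n\<in>N. if n = k then x (c, n) else 0)"
      using ends[OF kl] by (intro sum.cong) (auto simp: nb_weight_def)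
    also have "\<dots> = (if k \<in> N then x (c, k) else 0)" using fin by simp
    finally have "(\<Sum>n\<in>N. nb_weight (k, l) (c, n) * x (c, n)) = (if k \<in> N then x (c, k) else 0)" .
    moreover have "(\<Sum>n\<in>N. nb_weight (k, l) (n, c) * x (n, c)) = 0"
      using ends[OF kl] by (auto simp: nb_weight_def intro!: sum.neutral)
    moreover have "(k, l) \<in> F" using kl by (simp add: F_def)
    ultimately show ?thesis using eig[of "(k, l)"] by (simp add: split)
  qed
  have out: "t * x (c, m) = (\<Sum>n\<in>N. if n \<noteq> m then x (n, c) else 0)" if "m \<in> N" for m
  proof -
    have "(\<Sum>f\<in>E. nb_weight (c, m) f * x f) = 0" "(\<Sum>n\<in>N. nb_weight (c, m) (c, n) * x (c, n)) = 0"
      using c ends by (auto simp: nb_weight_def intro!: sum.neutral)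
    moreover have "(\<Sum>n\<in>N. nb_weight (c, m) (n, c) * x (n, c)) = (\<Sum>n\<in>N. if n \<noteq> m then x (n, c) else 0)"
      by (intro sum.cong) (auto simp: nb_weight_def)
    ultimately show ?thesis using eig[of "(c, m)"] that by (simp add: split mem_new)
  qed
  have "in": "t * x (n, c) = (\<Sum>f\<in>E. if snd f = n then x f else 0)" if "n \<in> N" for n
  proof -
    have "(\<Sum>m\<in>N. nb_weight (n, c) (c, m) * x (c, m)) = 0" "(\<Sum>m\<in>N. nb_weight (n, c) (m, c) * x (m, c)) = 0"
      using c that by (auto simp: nb_weight_def intro!: sum.neutral)
    moreover have "(\<Sum>f\<in>E. nb_weight (n, c) f * x f) = (\<Sum>f\<in>E. if snd f = n then x f else 0)"
    proof (intro sum.cong refl)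
      show "nb_weight (n, c) f * x f = (if snd f = n then x f else 0)" if "f \<in> E" for f
        using ends[of "fst f" "snd f"] that by (auto simp: nb_weight_def)
    qed
    ultimately show ?thesis using eig[of "(n, c)"] that by (simp add: split mem_new)
  qed
  have "t\<^sup>2 * x (c, m) = (\<Sum>f\<in>E. if snd f \<in> N \<and> snd f \<noteq> m then x f else 0)" if "m \<in> N" for m
  proof -
    have "t\<^sup>2 * x (c, m) = (\<Sum>n\<in>N. if n \<noteq> m then t * x (n, c) else 0)"
      using out[OF that] by (simp add: power2_eq_square sum_distrib_left if_distrib mult.assoc cong: if_cong)
    also have "\<dots> = (\<Sum>n\<in>N. \<Sum>f\<in>E. if snd f = n \<and> n \<noteq> m then x f else 0)"
      by (intro sum.cong) (auto simp: "in" intro!: sum.cong)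
    also have "\<dots> = (\<Sum>f\<in>E. \<Sum>n\<in>N. if n = snd f then (if snd f \<noteq> m then x f else 0) else 0)"
      by (subst sum.swap) (intro sum.cong, auto)
    also have "\<dots> = (\<Sum>f\<in>E. if snd f \<in> N \<and> snd f \<noteq> m then x f else 0)"
      using fin by (intro sum.cong) auto
    finally show ?thesis .
  qed
  then show ?thesis using tail by auto
qed

section \<open>The eigenvalue of the extended graph\<close>

theorem theorem6p2:
  fixes G :: "'a pair_pre_digraph" and c :: 'a and N :: "'a set" and d :: nat
    and es esc :: "('a \<times> 'a) list" and \<mu> :: real
  assumes "pair_graph G"
    and "Digraph_Component.connected (with_proj G)"
    and "\<forall>v \<in> pverts G. 2 \<le> out_degree (with_proj G) v"
    and "c \<notin> pverts G" and "N \<subseteq> pverts G" and "card N = d" and "2 \<le> d"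
    and "Digraph_Component.connected (with_proj (add_node G c N))"
    and "enumerates es (parcs G)"
    and "enumerates esc (parcs (add_node G c N))"
    and "diagonalizable_mat (nb_matrix es)"
    and "perron_eigenvalue (nb_matrix es) \<mu>"
  shows "\<exists>\<mu>\<^sub>c::real. \<mu> < \<mu>\<^sub>c
    \<and> eigenvalue (resolvent (nb_matrix es) (complex_of_real \<mu>\<^sub>c) * X_matrix (add_node G c N) c es)
        (complex_of_real (- (\<mu>\<^sub>c\<^sup>2)))
    \<and> eigenvalue (nb_matrix esc) (complex_of_real \<mu>\<^sub>c)"
proof -
  interpret G: pair_graph G by fact
  let ?E = "parcs G"
  let ?F = "?E \<union> {c} \<times> N \<union> N \<times> {c}"
  have F: "parcs (add_node G c N) = ?F" by (simp add: add_node_def)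
  have es: "distinct es" "set es = ?E" and esc: "distinct esc" "set esc = ?F"
    using assms(9,10) by (auto simp: enumerates_def F)
  have fin: "finite ?E" "finite N"
    using G.finite_arcs finite_subset[OF assms(5)] G.finite_verts by auto
  have sym: "sym ?E" using G.sym_arcs by (simp add: symmetric_def)
  have E_verts: "u \<in> pverts G \<and> v \<in> pverts G" if "(u, v) \<in> ?E" for u v
    using that by (auto dest: G.in_arcsD1 G.in_arcsD2)
  have c: "c \<notin> Field ?E" "c \<notin> N" using assms(4,5) E_verts by (auto simp: Field_def)
  have branch: "\<exists>x. (v, x) \<in> ?E \<and> x \<noteq> w" if "v \<in> pverts G" for v w
  proof (rule ccontr)
    assume "\<not> ?thesis"
    then have "out_arcs (with_proj G) v \<subseteq> {(v, w)}" by (auto simp: out_arcs_def)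
    then have "out_degree (with_proj G) v \<le> card {(v, w)}"
      unfolding out_degree_def by (intro card_mono) auto
    then show False using assms(3) that by fastforce
  qed
  have reach: "(v, n) \<in> ?E\<^sup>*" if "(u, v) \<in> ?E" "n \<in> N" for u v n
  proof -
    have "strongly_connected (with_proj G)"
      using G.symmetric_connected_imp_strongly_connected assms(2) G.sym_arcs by blast
    then have "v \<rightarrow>\<^sup>*\<^bsub>with_proj G\<^esub> n" 
      using E_verts[OF that(1)] that(2) assms(5) by (auto simp: strongly_connected_def)
    then show ?thesis using reachable_rtranclI by fastforce
  qed
  have two: "\<exists>n\<in>N. n \<noteq> m" for m
  proof (rule ccontr)
    assume "\<not> ?thesis"
    then have "card N \<le> card {m}" by (intro card_mono) auto
    then show False using assms(6,7) by simp
  qed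
  have N: "N \<subseteq> Domain ?E" using branch assms(5) by blast
  interpret P: irreducible_nonneg ?F nb_weight
  proof
    show "finite ?F" using fin by simp
    show "0 \<le> nb_weight e f" for e f :: "'a \<times> 'a" by (simp add: nb_weight_def)
    show "(e, f) \<in> {(e, f). e \<in> ?F \<and> f \<in> ?F \<and> 0 < nb_weight e f}\<^sup>*"
      if "e \<in> ?F" "f \<in> ?F" for e f
    proof -
      have "(f, e) \<in> (nb_next ?F)\<^sup>*"
      proof (rule nb_strongly_connected_add_vertex[OF fin(1) sym])
        show "\<exists>x. (v, x) \<in> ?E \<and> x \<noteq> w" if "v \<in> Range ?E" for v w
          using that E_verts branch by blast
        show "(v, n) \<in> ?E\<^sup>*" if "(u, v) \<in> ?E" "n \<in> N" for u v n
          using that by (rule reach)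
      qed (rule c N two that)+
      then show ?thesis unfolding nb_weight_support by (rule rtrancl_converseI)
    qed
  qed

  obtain v where v: "\<exists>e\<in>?E. v e \<noteq> 0"
    and eig: "\<And>e. e \<in> ?E \<Longrightarrow> (\<Sum>f\<in>?E. nb_entry e f * v f) = complex_of_real \<mu> * v e"
    and \<mu>: "0 < \<mu>" "\<mu> = spectral_radius (nb_matrix es)"
    using assms(12) unfolding perron_eigenvalue_def nb_matrix_def eigenvalue_indexed_mat_iff[OF es(1)] es(2)
    by blast
  \<comment> \<open>Passing to moduli turns the eigenvalue equation for \<open>B\<close> into an inequality for \<open>B\<^sup>c\<close>.\<close>
  define u where "u e = (if e \<in> ?E then cmod (v e) else 0)" for e
  have "\<exists>r y. \<mu> < r \<and> (\<forall>e\<in>?F. 0 < y e \<and> P.act y e = r * y e)"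
  proof -
    obtain e\<^sub>0 where e\<^sub>0: "e\<^sub>0 \<in> ?E" "v e\<^sub>0 \<noteq> 0" using v by blast
    obtain n where n: "n \<in> N" using two by blast
    have sub: "\<mu> * u e \<le> P.act u e" for e
    proof (cases "e \<in> ?E")
      case True
      have "\<mu> * u e = cmod (\<Sum>f\<in>?E. nb_entry e f * v f)"
        using True \<mu>(1) by (simp add: eig u_def norm_mult)
      also have "\<dots> \<le> (\<Sum>f\<in>?E. nb_weight e f * u f)"
        by (intro sum_norm_le) (simp add: nb_entry_eq_weight u_def norm_mult nb_weight_def)
      also have "\<dots> \<le> P.act u e"
        unfolding P.act_def using fin by (intro sum_mono2) (auto simp: u_def nb_weight_def)
      finally show ?thesis .
    next
      case False
      then show ?thesis unfolding P.act_def by (auto simp: u_def nb_weight_def intro!: sum_nonneg)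
    qed
    \<comment> \<open>The required zero entry of \<open>u\<close> sits on a new edge.\<close>
    show ?thesis
      using e\<^sub>0 n sub c by (intro P.larger_eigenvalue[of u e\<^sub>0 _ "(c, n)"]) (auto simp: u_def Field_def)
  qed
  then obtain r y where r: "\<mu> < r" and y: "\<And>e. e \<in> ?F \<Longrightarrow> 0 < y e"
    and yr: "\<And>e. e \<in> ?F \<Longrightarrow> (\<Sum>f\<in>?F. nb_weight e f * y f) = r * y e"
    unfolding P.act_def by blast

  let ?B = "nb_matrix es" and ?X = "X_matrix (add_node G c N) c es"
  let ?y = "\<lambda>e. complex_of_real (y e)"
  have E: "\<exists>e\<in>?E. ?y e \<noteq> 0" using v y by force
  have "eigenvalue (nb_matrix esc) (complex_of_real r)"
    unfolding nb_matrix_def eigenvalue_indexed_mat_iff[OF esc(1)] esc(2)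
    using E yr by (intro exI[of _ ?y]) (auto simp: nb_entry_eq_weight simp flip: of_real_mult of_real_sum)
  moreover have "eigenvalue (resolvent ?B (complex_of_real r) * ?X) (complex_of_real (- (r\<^sup>2)))"
  proof (rule eigenvalue_resolvent_mult[of _ "length es"])
    show "?B \<in> carrier_mat (length es) (length es)" "?X \<in> carrier_mat (length es) (length es)"
      by (simp_all add: nb_matrix_def X_matrix_def)
    then show "\<not> eigenvalue ?B (complex_of_real r)"
      using r \<mu> by (intro not_eigenvalue_above_spectral_radius) auto
    show "indexed_vec es ?y \<in> carrier_vec (length es)" by simp
    show "indexed_vec es ?y \<noteq> 0\<^sub>v (length es)"
      using E by (simp add: zero_vec_indexed indexed_vec_eq_iff es(2))
    have "(\<Sum>f\<in>?E. X_entry (add_node G c N) c e f * ?y f)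
        = complex_of_real (- (r\<^sup>2)) * ((\<Sum>f\<in>?E. nb_entry e f * ?y f) - complex_of_real r * ?y e)"
      if e: "e \<in> ?E" for e
    proof -
      obtain k l where kl: "e = (k, l)" by (cases e)
      have adj: "Defs.adj (add_node G c N) c w = (if w \<in> N then 1 else 0)" for w
        using c by (auto simp: Defs.adj_def F Field_def)
      have "(\<Sum>f\<in>?E. X_entry (add_node G c N) c e f * ?y f)
          = (\<Sum>f\<in>?E. complex_of_real (if k \<in> N \<and> snd f \<in> N \<and> snd f \<noteq> k then y f else 0))"
        by (intro sum.cong) (auto simp: X_entry_def kl adj kdelta_def)
      also have "\<dots> = complex_of_real (r\<^sup>2 * (r * y e - (\<Sum>f\<in>?E. nb_weight e f * y f)))"
        using eliminate_new_vertex[OF fin c yr] e unfolding kl by simp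
      also have "\<dots> = complex_of_real (- (r\<^sup>2)) * ((\<Sum>f\<in>?E. nb_entry e f * ?y f) - complex_of_real r * ?y e)"
        by (simp add: nb_entry_eq_weight algebra_simps)
      finally show ?thesis .
    qed
    then show "?X *\<^sub>v indexed_vec es ?y = complex_of_real (- (r\<^sup>2)) \<cdot>\<^sub>v
        (?B *\<^sub>v indexed_vec es ?y - complex_of_real r \<cdot>\<^sub>v indexed_vec es ?y)"
      by (simp add: X_matrix_def nb_matrix_def indexed_mat_mult_vec es smult_indexed_vec
          diff_indexed_vec indexed_vec_eq_iff)
  qed
  ultimately show ?thesis using r by blast
qed

end
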